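(* Let $n\ge 1$ be an integer, let $a_1,\dots,a_n\in\mathbb{C}$ with $|a_j|>1$ for all $j$, and let $W(z)=\prod_{j=1}^n(z-a_j)$ and $B(z)=\prod_{j=1}^n\frac{1-\overline{a_j}z}{z-a_j}$. Let $k\ge 1$ be real and suppose $R\in\mathcal{R}_n(a_1,\dots,a_n)$ has all its zeros in $\{z\in\mathbb{C}:|z|\ge k\}$; that is, $R(z)=\frac{P(z)}{W(z)}$ with $P(z)=\alpha_m\prod_{j=1}^m(z-b_j)$, $\alpha_m\ne 0$, $m\le n$, and $|b_j|\ge k\ge 1$ for $j=1,\dots,m$. Let $\lambda\in\mathbb{C}$ with $|\lambda|=1$, let $t_1,\dots,t_n$ be the $n$ roots of $B(z)=\lambda$ and $s_1,\dots,s_n$ the $n$ roots of $B(z)=-\lambda$, and put $M_1=\max_{1\le j\le n}|R(t_j)|$, $M_2=\max_{1\le j\le n}|R(s_j)|$. Then for every $z\in\mathbb{C}$ with $|z|=1$, $$|R'(z)|\le\frac12\left[|B'(z)|^2-\frac{2n(k-1)}{k+1}\frac{|R(z)|^2|B'(z)|}{M_1^2+M_2^2}-\frac{4|R(z)|^2|B'(z)|}{M_1^2+M_2^2}\left\{\frac{n}{1+k}-\sum_{j=1}^m\frac{1}{1+|b_j|}\right\}\right]^{1/2}\left(M_1^2+M_2^2\right)^{1/2}.$$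
   Context: $\mathcal{R}_n(a_1,\dots,a_n)=\{P(z)/W(z): P \text{ a complex polynomial of degree at most } n\}$, where $W(z)=\prod_{j=1}^n(z-a_j)$; the $a_j$ need not be distinct. It is known that for $|\lambda|=1$ the equation $B(z)=\lambda$ has exactly $n$ simple roots, all lying on the unit circle. *)

theory Defs
  imports "HOL-Analysis.Analysis" "HOL-Computational_Algebra.Polynomial"
begin

text \<open>
  The poles form a family \<open>a 1, \<dots>, a n\<close>, possibly with repetitions. Functions are total, so quotients
  take the value 0 at the poles.
\<close>

definition pole_product :: "nat \<Rightarrow> (nat \<Rightarrow> complex) \<Rightarrow> complex \<Rightarrow> complex" where
  "pole_product n a z = (\<Prod>j=1..n. (z - a j))"

definition blaschke :: "nat \<Rightarrow> (nat \<Rightarrow> complex) \<Rightarrow> complex \<Rightarrow> complex" where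
  "blaschke n a z = (\<Prod>j=1..n. (1 - cnj (a j) * z) / (z - a j))"

definition rational_space :: "nat \<Rightarrow> (nat \<Rightarrow> complex) \<Rightarrow> (complex \<Rightarrow> complex) set" where
  "rational_space n a = {\<lambda>z. poly P z / pole_product n a z | P. degree P \<le> n}"

text \<open>
  For \<open>w \<noteq> 0\<close> the poles do not occur among the solutions, as \<open>blaschke n a\<close> vanishes there by totality.
  For \<open>\<bar>w\<bar> = 1\<close> the equation has exactly \<open>n\<close> roots, all of them simple, so an enumeration by
  \<open>{1..n}\<close> is a bijection.
\<close>

definition enumerates_roots ::
  "nat \<Rightarrow> (nat \<Rightarrow> complex) \<Rightarrow> complex \<Rightarrow> (nat \<Rightarrow> complex) \<Rightarrow> bool" where
  "enumerates_roots n a w t \<longleftrightarrow> bij_betw t {1..n} {z. blaschke n a z = w}"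

end

theory Submission
  imports Defs
begin

text \<open>
  On the unit circle \<open>z B'(z) / B(z)\<close> equals the positive number \<open>weight z = \<bar>B'(z)\<bar>\<close>.
  Differentiating the partial fraction expansion of \<open>R / (B - \<lambda>)\<close>, whose poles are the
  \<open>t j\<close>, writes \<open>B' R - R' (B - \<lambda>)\<close> as a sum of the values \<open>R (t j)\<close> with weights of equal argument; the
  case \<open>R = 1\<close> gives the total weight \<open>B'\<close>, hence \<open>\<bar>B' R - R' (B - \<lambda>)\<bar> \<le> \<bar>B'\<bar> M1\<close>.
  Combining this with the bound for \<open>-\<lambda>\<close> by the parallelogram law yields
  \<open>\<bar>R'\<bar>\<^sup>2 + \<bar>\<bar>B'\<bar> R - z R'\<bar>\<^sup>2 \<le> \<bar>B'\<bar>\<^sup>2 (M1\<^sup>2 + M2\<^sup>2) / 2\<close>.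
  The location of the zeros bounds \<open>Re (z R' / R)\<close> from above, so that the second square on the
  left exceeds the first by at least \<open>\<bar>R\<bar>\<^sup>2 \<bar>B'\<bar> (n - 2 \<Sum> 1 / (1 + \<bar>b j\<bar>))\<close>.
\<close>

section \<open>Lagrange interpolation with an extra leading term\<close>

lemma prod_diff_nonzero:
  fixes t :: "'i \<Rightarrow> 'a::idom"
  assumes "inj_on t I" "j \<in> I"
  shows "(\<Prod>i\<in>I - {j}. (t j - t i)) \<noteq> 0"
proof
  assume "(\<Prod>i\<in>I - {j}. (t j - t i)) = 0"
  then obtain i where "i \<in> I - {j}" "t j = t i"
    by (cases "finite (I - {j})") auto
  thus False
    using assms by (auto dest: inj_onD)
qed

text \<open>Interpolation at \<open>n\<close> nodes determines polynomials of degree below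
  \<open>n\<close>; degree \<open>n\<close> leaves a free multiple of the node polynomial. Divided
  by that polynomial, the formula becomes a partial fraction expansion with constant term
  \<open>C\<close>.\<close>

lemma poly_lagrange_leading:
  fixes t :: "nat \<Rightarrow> complex"
  assumes inj: "inj_on t {1..n}" and deg: "degree P \<le> n"
  shows "\<exists>C. \<forall>x. poly P x = C * (\<Prod>j=1..n. (x - t j))
    + (\<Sum>j=1..n. poly P (t j) / (\<Prod>i\<in>{1..n}-{j}. (t j - t i)) * (\<Prod>i\<in>{1..n}-{j}. (x - t i)))"
proof -
  define Q where "Q = (\<Prod>j=1..n. [:- t j, 1:])"
  define D where "D j = (\<Prod>i\<in>{1..n}-{j}. (t j - t i))" for j
  define N where "N j = (\<Prod>i\<in>{1..n}-{j}. [:- t i, 1:])" for j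
  define L where "L = (\<Sum>j=1..n. smult (poly P (t j) / D j) (N j))"
  \<comment> \<open>The coefficient at exactly \<open>n\<close>, hence 0 when \<open>P\<close> has
    smaller degree.\<close>
  define C where "C = coeff P n"
  have degQ: "degree Q = n"
    unfolding Q_def by (subst degree_prod_eq_sum_degree) auto
  have "lead_coeff Q = 1"
    unfolding Q_def by (simp add: lead_coeff_prod)
  hence coeffQ: "coeff Q n = 1"
    by (simp add: degQ)
  have degN: "degree (N j) < n" if "j \<in> {1..n}" for j
    using that unfolding N_def by (subst degree_prod_eq_sum_degree) auto
  have coeffL: "coeff L n = 0"
    unfolding L_def coeff_sum using degN by (auto intro!: sum.neutral simp: coeff_eq_0)
  have degL: "degree L \<le> n"
    unfolding L_def
  proof (rule degree_sum_le)
    fix j assume "j \<in> {1..n}"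
    thus "degree (smult (poly P (t j) / D j) (N j)) \<le> n"
      using degN[of j] degree_smult_le[of "poly P (t j) / D j" "N j"] by linarith
  qed simp
  have D0: "D j \<noteq> 0" if "j \<in> {1..n}" for j
    unfolding D_def using prod_diff_nonzero[OF inj that] .
  \<comment> \<open>Both sides have degree at most \<open>n\<close>, the same coefficient at
    \<open>n\<close>, and the same values at the \<open>n\<close> distinct nodes.\<close>
  have "P = smult C Q + L"
  proof (rule poly_eqI_degree_lead_coeff[where A = "t ` {1..n}" and n = n])
    show "coeff P n = coeff (smult C Q + L) n"
      by (simp add: C_def coeffQ coeffL)
    show "card (t ` {1..n}) \<ge> n"
      using inj by (simp add: card_image)
    show "degree (smult C Q + L) \<le> n"
      using degQ degL by (intro degree_add_le) (auto intro: order.trans[OF degree_smult_le])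
    fix x assume "x \<in> t ` {1..n}"
    then obtain l where l: "l \<in> {1..n}" "x = t l" by auto
    have Nl: "poly (N j) x = (if j = l then D l else 0)" if "j \<in> {1..n}" for j
      using l that by (auto simp: N_def D_def poly_prod)
    have "poly L x = (\<Sum>j=1..n. if j = l then poly P (t l) / D l * D l else 0)"
      unfolding L_def poly_sum by (intro sum.cong) (auto simp: Nl)
    also have "\<dots> = poly P x"
      using l D0[of l] by simp
    finally have "poly L x = poly P x" .
    moreover have "poly Q x = 0"
      using l by (auto simp: Q_def poly_prod)
    ultimately show "poly P x = poly (smult C Q + L) x"
      by simp
  qed (use deg in auto)
  hence eq: "poly P x = C * poly Q x + poly L x" for x
    by (metis poly_add poly_smult)
  show ?thesis
  proof (intro exI[of _ C] allI)
    fix x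
    have "poly Q x = (\<Prod>j=1..n. (x - t j))"
      by (simp add: Q_def poly_prod)
    moreover have "poly L x = (\<Sum>j=1..n. poly P (t j) / D j * (\<Prod>i\<in>{1..n}-{j}. (x - t i)))"
      by (simp add: L_def N_def poly_sum poly_prod)
    ultimately show "poly P x = C * (\<Prod>j=1..n. (x - t j))
        + (\<Sum>j=1..n. poly P (t j) / (\<Prod>i\<in>{1..n}-{j}. (t j - t i)) * (\<Prod>i\<in>{1..n}-{j}. (x - t i)))"
      using eq[of x] unfolding D_def by (simp only:)
  qed
qed

section \<open>Identities for points on the unit circle\<close>

text \<open>The last product compares numerator and denominator of a Blaschke factor: it vanishes on
  the circle, and for |c| > 1 its sign tells inside from outside.\<close>

lemma norm_one_minus_cnj_mult_sq:
  "(norm (1 - cnj c * z))\<^sup>2 = (norm (z - c))\<^sup>2 + (1 - (norm z)\<^sup>2) * (1 - (norm c)\<^sup>2)"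
  unfolding cmod_power2 by (simp add: power2_eq_square algebra_simps)

text \<open>Serves twice: for a pole, the quotient on the right is a summand of |B'|; for a zero, it
  is estimated from below.\<close>

lemma Re_divide_diff_eq:
  assumes "norm z = 1" "z \<noteq> b"
  shows "Re (z / (z - b)) = (1 - ((norm b)\<^sup>2 - 1) / (norm (z - b))\<^sup>2) / 2"
proof -
  have n0: "norm (z - b) > 0"
    using assms by simp
  have z1: "(Re z)\<^sup>2 + (Im z)\<^sup>2 = 1"
    using assms cmod_power2[of z] by simp
  have "Re (z / (z - b)) * (2 * (norm (z - b))\<^sup>2) = 2 * Re (z * cnj (z - b))"
    using n0 by (simp add: complex_div_cnj[of z] Re_divide_of_real del: of_real_power flip: of_real_power)
  also have "\<dots> = (norm (z - b))\<^sup>2 + 1 - (norm b)\<^sup>2"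
    using z1 unfolding cmod_power2 by (simp add: power2_eq_square algebra_simps)
  finally show ?thesis
    using n0 by (simp add: field_simps)
qed

text \<open>For |b| \<ge> 1 the exact value increases with |z - b|, which is at most 1 +
  |b|.\<close>

lemma Re_divide_diff_le:
  assumes "norm z = 1" "norm b \<ge> 1" "z \<noteq> b"
  shows "Re (z / (z - b)) \<le> 1 / (1 + norm b)"
proof -
  have n0: "norm (z - b) > 0"
    using assms by simp
  have "norm (z - b) \<le> 1 + norm b"
    using norm_triangle_ineq4[of z b] assms by simp
  hence "(norm (z - b))\<^sup>2 \<le> (1 + norm b)\<^sup>2"
    by (intro power_mono) auto
  moreover have "(norm b)\<^sup>2 - 1 \<ge> 0"
    using assms by simp
  ultimately have "((norm b)\<^sup>2 - 1) / (1 + norm b)\<^sup>2 \<le> ((norm b)\<^sup>2 - 1) / (norm (z - b))\<^sup>2"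
    using n0 assms(2) by (intro divide_left_mono mult_pos_pos zero_less_power) auto
  moreover have "((norm b)\<^sup>2 - 1) / (1 + norm b)\<^sup>2 = 1 - 2 / (1 + norm b)"
    using add_pos_nonneg[of 1 "norm b"] by (simp add: divide_simps power2_eq_square) (simp add: algebra_simps)
  ultimately show ?thesis
    unfolding Re_divide_diff_eq[OF assms(1,3)] by (simp add: field_simps)
qed

text \<open>Conjugation is inversion on the circle, so |z - t|^2 = -(z - t)^2 / (z t). Hence the
  argument of the left side does not depend on \<open>t\<close>.\<close>

lemma unit_circle_divide_diff_sq:
  fixes z t :: complex
  assumes "norm z = 1" "norm t = 1" "z \<noteq> t"
  shows "t / (z - t)\<^sup>2 = - 1 / (z * of_real ((norm (z - t))\<^sup>2))"
proof -
  have z: "z * cnj z = 1" and t: "t * cnj t = 1"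
    using assms complex_norm_square[of z] complex_norm_square[of t] by simp_all
  have nz: "z \<noteq> 0" "t \<noteq> 0" using assms by auto
  have "of_real ((norm (z - t))\<^sup>2) = (z - t) * (cnj z - cnj t)"
    unfolding complex_norm_square by simp
  also have "cnj z = 1 / z" using z nz by (simp add: field_simps)
  also have "cnj t = 1 / t" using t nz by (simp add: field_simps)
  finally have eq: "of_real ((norm (z - t))\<^sup>2) = - ((z - t)\<^sup>2 / (z * t))"
    using nz by (simp add: field_simps power2_eq_square)
  show ?thesis
    unfolding eq using nz assms(3) by (simp add: field_simps)
qed

section \<open>The Blaschke product on the unit circle\<close>

locale exterior_poles =
  fixes n :: nat and a :: "nat \<Rightarrow> complex"
  assumes n_pos: "n \<ge> 1"
    and norm_pole: "\<And>j. j \<in> {1..n} \<Longrightarrow> norm (a j) > 1"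
begin

abbreviation "W \<equiv> pole_product n a"
abbreviation "B \<equiv> blaschke n a"

definition weight :: "complex \<Rightarrow> real" where
  "weight z = (\<Sum>j=1..n. ((norm (a j))\<^sup>2 - 1) / (norm (z - a j))\<^sup>2)"

lemma pole_product_nonzero: "norm z = 1 \<Longrightarrow> W z \<noteq> 0"
  using norm_pole by (force simp: pole_product_def)

lemma open_nonpoles: "open {x. W x \<noteq> 0}"
proof -
  have "continuous_on UNIV W"
    unfolding pole_product_def by (intro continuous_intros)
  from open_Collect_neq[OF this continuous_on_const] show ?thesis .
qed

lemma weight_pos:
  assumes "norm z = 1"
  shows "weight z > 0"
  unfolding weight_def
proof (rule sum_pos)
  fix j assume j: "j \<in> {1..n}"
  have "(norm (a j))\<^sup>2 > 1" "z \<noteq> a j"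
    using norm_pole[OF j] assms by (auto simp: one_less_power)
  thus "((norm (a j))\<^sup>2 - 1) / (norm (z - a j))\<^sup>2 > 0"
    by simp
qed (use n_pos in auto)

lemma norm_blaschke:
  assumes "norm z = 1"
  shows "norm (B z) = 1"
proof -
  have "norm ((1 - cnj (a j) * z) / (z - a j)) = 1" if "j \<in> {1..n}" for j
  proof -
    have "norm (1 - cnj (a j) * z) = norm (z - a j)"
    proof (rule power2_eq_imp_eq)
      show "(norm (1 - cnj (a j) * z))\<^sup>2 = (norm (z - a j))\<^sup>2"
        unfolding norm_one_minus_cnj_mult_sq assms by simp
    qed simp_all
    moreover have "z \<noteq> a j" using norm_pole[OF that] assms by auto
    ultimately show ?thesis by (simp add: norm_divide)
  qed
  thus ?thesis
    unfolding blaschke_def by (simp add: prod_norm[symmetric])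
qed

text \<open>Since |a j| > 1, every factor has modulus below 1 inside the disc and, off the poles,
  above 1 outside, so the product can have modulus 1 only on the circle. This places the
  interpolation nodes there.\<close>

lemma norm_eq_1_of_blaschke:
  assumes "norm (B t) = 1"
  shows "norm t = 1"
proof (rule ccontr)
  assume ne: "norm t \<noteq> 1"
  define f where "f j = norm ((1 - cnj (a j) * t) / (t - a j))" for j
  have prod_eq: "(\<Prod>j=1..n. f j) = 1"
    using assms by (simp add: blaschke_def f_def prod_norm)
  have nz: "t \<noteq> a j" if j: "j \<in> {1..n}" for j
  proof
    \<comment> \<open>At a pole the factor is 0, division by zero being 0, so poles cannot be
      solutions.\<close>
    assume "t = a j"
    hence "f j = 0" by (simp add: f_def)
    hence "(\<Prod>j=1..n. f j) = 0"
      using j by (intro prod_zero finite_atLeastAtMost bexI[of _ j])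
    thus False using prod_eq by linarith
  qed
  have a1: "(norm (a j))\<^sup>2 > 1" if "j \<in> {1..n}" for j
    using norm_pole[OF that] by (simp add: one_less_power)
  consider "norm t < 1" | "norm t > 1" using ne by linarith
  thus False
  proof cases
    case 1
    have "f j < 1" if j: "j \<in> {1..n}" for j
    proof -
      have "(norm t)\<^sup>2 < 1" using 1 power_strict_mono[of "norm t" 1 2] by simp
      hence "(1 - (norm t)\<^sup>2) * (1 - (norm (a j))\<^sup>2) < 0"
        using a1[OF j] by (intro mult_pos_neg) auto
      hence "(norm (1 - cnj (a j) * t))\<^sup>2 < (norm (t - a j))\<^sup>2"
        using norm_one_minus_cnj_mult_sq[of "a j" t] by simp
      hence "norm (1 - cnj (a j) * t) < norm (t - a j)"
        by (rule power_less_imp_less_base) simp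
      thus ?thesis using nz[OF j] by (simp add: f_def norm_divide)
    qed
    hence "(\<Prod>j=1..n. f j) < (\<Prod>j=1..n. 1)"
      using n_pos by (intro prod_mono_strict[of 1]) (use n_pos in \<open>auto simp: f_def less_imp_le\<close>)
    thus False using prod_eq by simp
  next
    case 2
    have "f j > 1" if j: "j \<in> {1..n}" for j
    proof -
      have "(norm t)\<^sup>2 > 1" using 2 by (simp add: one_less_power)
      hence "(1 - (norm t)\<^sup>2) * (1 - (norm (a j))\<^sup>2) > 0"
        using a1[OF j] by (intro mult_neg_neg) auto
      hence "(norm (1 - cnj (a j) * t))\<^sup>2 > (norm (t - a j))\<^sup>2"
        using norm_one_minus_cnj_mult_sq[of "a j" t] by simp
      hence "norm (1 - cnj (a j) * t) > norm (t - a j)"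
        by (rule power_less_imp_less_base) simp
      thus ?thesis using nz[OF j] by (simp add: f_def norm_divide)
    qed
    hence "(\<Prod>j=1..n. f j) > 1"
      using n_pos by (intro less_1_prod) auto
    thus False using prod_eq by simp
  qed
qed

text \<open>Logarithmic differentiation: no factor vanishes on the circle, and each contributes one
  summand of \<open>weight z\<close>, divided by \<open>z\<close>.\<close>

lemma blaschke_has_field_derivative:
  assumes "norm z = 1"
  shows "(B has_field_derivative B z / z * of_real (weight z)) (at z)"
proof -
  have ne: "z \<noteq> a j" "1 - cnj (a j) * z \<noteq> 0" if j: "j \<in> {1..n}" for j
  proof -
    show "z \<noteq> a j" using norm_pole[OF j] assms by auto
    have "norm (cnj (a j) * z) > 1" using norm_pole[OF j] assms by (simp add: norm_mult)
    hence "cnj (a j) * z \<noteq> 1" by (metis less_irrefl norm_one)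
    thus "1 - cnj (a j) * z \<noteq> 0" by (metis right_minus_eq)
  qed
  have nz: "z \<noteq> 0" using assms by auto
  have zz: "z * cnj z = 1" using assms complex_norm_square[of z] by simp
  define g where "g j = (of_real ((norm (a j))\<^sup>2) - 1) / (z - a j)\<^sup>2" for j
  have "((\<lambda>u. \<Prod>j=1..n. (1 - cnj (a j) * u) / (u - a j)) has_field_derivative
      (\<Prod>j=1..n. (1 - cnj (a j) * z) / (z - a j)) *
      (\<Sum>j=1..n. g j / ((1 - cnj (a j) * z) / (z - a j)))) (at z)"
  proof (rule has_field_derivative_prod')
    fix j assume j: "j \<in> {1..n}"
    show "((\<lambda>u. (1 - cnj (a j) * u) / (u - a j)) has_field_derivative g j) (at z)"
      using ne[OF j] unfolding g_def complex_norm_square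
      by (auto intro!: derivative_eq_intros simp: power2_eq_square algebra_simps)
  qed (use ne in auto)
  moreover have "g j / ((1 - cnj (a j) * z) / (z - a j)) =
      1 / z * of_real (((norm (a j))\<^sup>2 - 1) / (norm (z - a j))\<^sup>2)" if j: "j \<in> {1..n}" for j
  proof -
    \<comment> \<open>Replacing z * cnj z by 1 turns |z - a j|^2 into the product of numerator and
      denominator of the factor, up to \<open>z\<close>.\<close>
    have "z * of_real ((norm (z - a j))\<^sup>2) = (z - a j) * (z * cnj z - cnj (a j) * z)"
      unfolding complex_norm_square by (simp add: algebra_simps)
    hence "z * of_real ((norm (z - a j))\<^sup>2) = (z - a j) * (1 - cnj (a j) * z)"
      by (simp only: zz)
    hence eq: "1 / z * of_real (((norm (a j))\<^sup>2 - 1) / (norm (z - a j))\<^sup>2) =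
        (of_real ((norm (a j))\<^sup>2) - 1) / ((z - a j) * (1 - cnj (a j) * z))"
      by (metis (no_types, lifting) divide_divide_eq_left' mult.commute mult_1 of_real_1 of_real_diff of_real_divide times_divide_eq_left times_divide_eq_right)
    show ?thesis
      unfolding eq g_def using ne[OF j] by (simp add: power2_eq_square)
  qed
  hence "(\<Sum>j=1..n. g j / ((1 - cnj (a j) * z) / (z - a j))) =
      (\<Sum>j=1..n. 1 / z * of_real (((norm (a j))\<^sup>2 - 1) / (norm (z - a j))\<^sup>2))"
    by (rule sum.cong[OF refl])
  ultimately have "((\<lambda>u. \<Prod>j=1..n. (1 - cnj (a j) * u) / (u - a j)) has_field_derivative
      (\<Prod>j=1..n. (1 - cnj (a j) * z) / (z - a j)) *
      (\<Sum>j=1..n. 1 / z * of_real (((norm (a j))\<^sup>2 - 1) / (norm (z - a j))\<^sup>2))) (at z)"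
    by (simp only:)
  thus ?thesis
    unfolding blaschke_def[abs_def] weight_def by (simp add: sum_distrib_left sum_distrib_right mult_ac)
qed

lemma norm_deriv_blaschke:
  assumes "norm z = 1"
  shows "norm (deriv B z) = weight z"
  using DERIV_imp_deriv[OF blaschke_has_field_derivative[OF assms]] weight_pos[OF assms] norm_blaschke[OF assms] assms
  by (simp add: norm_mult norm_divide)

section \<open>Interpolation at the roots of B = w\<close>

text \<open>This differentiates the partial fraction expansion of \<open>R / (B - w)\<close>. Since
  \<open>1 / deriv B (t j)\<close> and \<open>(z - t j)\<^sup>2\<close> have a ratio of argument independent of \<open>j\<close>, all weights
  in the sum can be made positive by a common factor, which is also independent of \<open>P\<close>.\<close>

lemma interpolation_formula:
  assumes w: "norm w = 1" and t: "enumerates_roots n a w t"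
    and z: "norm z = 1" "B z \<noteq> w"
  shows "\<exists>c. \<forall>P. degree P \<le> n \<longrightarrow>
    deriv B z * (poly P z / W z) - deriv (\<lambda>x. poly P x / W x) z * (B z - w) =
    c * (\<Sum>j=1..n. poly P (t j) / W (t j) / of_real (weight (t j) * (norm (z - t j))\<^sup>2))"
proof -
  have inj: "inj_on t {1..n}" and im: "t ` {1..n} = {x. B x = w}"
    using t by (auto simp: enumerates_roots_def bij_betw_def)
  have Bt: "B (t j) = w" if "j \<in> {1..n}" for j using im that by auto
  have tcirc: "norm (t j) = 1" if "j \<in> {1..n}" for j
    using norm_eq_1_of_blaschke Bt[OF that] w by simp
  have zt: "z \<noteq> t j" if "j \<in> {1..n}" for j using Bt[OF that] z by auto
  define Q where "Q x = (\<Prod>j=1..n. (x - t j))" for x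
  define D where "D j = (\<Prod>i\<in>{1..n}-{j}. (t j - t i))" for j
  \<comment> \<open>The numerator of \<open>B - w\<close> over the denominator \<open>W\<close>. It
    vanishes at all \<open>n\<close> nodes, so the interpolation formula leaves only a multiple of
    \<open>Q\<close>.\<close>
  define F where "F = (\<Prod>j=1..n. [:1, - cnj (a j):]) - smult w (\<Prod>j=1..n. [:- a j, 1:])"
  have degF: "degree F \<le> n"
  proof -
    have "degree (\<Prod>j=1..n. [:1, - cnj (a j):]) \<le> (\<Sum>j=1..n. 1)"
      by (rule order.trans[OF degree_prod_sum_le]) (auto intro!: sum_mono simp del: sum_constant)
    moreover have "degree (\<Prod>j=1..n. [:- a j, 1:]) \<le> (\<Sum>j=1..n. 1)"
      by (rule order.trans[OF degree_prod_sum_le]) (auto intro!: sum_mono simp del: sum_constant)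
    ultimately show ?thesis
      unfolding F_def by (intro degree_diff_le order.trans[OF degree_smult_le]) auto
  qed
  have F_eq: "poly F x = W x * (B x - w)" if "W x \<noteq> 0" for x
    using that unfolding F_def blaschke_def pole_product_def
    by (simp add: poly_prod prod_dividef field_simps)
  have Wt: "W (t j) \<noteq> 0" if "j \<in> {1..n}" for j
    using pole_product_nonzero tcirc[OF that] .
  have "\<exists>c. \<forall>x. poly F x = c * Q x + (\<Sum>j=1..n. poly F (t j) / D j * (\<Prod>i\<in>{1..n}-{j}. (x - t i)))"
    unfolding Q_def D_def using poly_lagrange_leading[OF inj degF] .
  then obtain c where c: "\<And>x. poly F x = c * Q x + (\<Sum>j=1..n. poly F (t j) / D j * (\<Prod>i\<in>{1..n}-{j}. (x - t i)))"
    by blast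
  have "poly F (t j) = 0" if "j \<in> {1..n}" for j
    using F_eq[OF Wt[OF that]] Bt[OF that] by simp
  hence FQ: "poly F x = c * Q x" for x
    using c[of x] by simp
  have c0: "c \<noteq> 0"
    using FQ[of z] F_eq[of z] pole_product_nonzero[OF z(1)] z(2) by auto
  have D0: "D j \<noteq> 0" if "j \<in> {1..n}" for j
    unfolding D_def using prod_diff_nonzero[OF inj that] .

  \<comment> \<open>Both sides are F'(t j), computed once from F = c Q and once from F = W (B -
    w).\<close>
  have cD: "c * D j = W (t j) * (w / t j * of_real (weight (t j)))" if j: "j \<in> {1..n}" for j
  proof -
    let ?N = "\<lambda>x. \<Prod>i\<in>{1..n}-{j}. (x - t i)"
    have "Q x = (x - t j) * ?N x" for x
      unfolding Q_def using j by (simp add: prod.remove)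
    hence pF: "poly F = (\<lambda>x. c * ((x - t j) * ?N x))" using FQ by auto
    have "(?N has_field_derivative (\<Sum>x\<in>{1..n}-{j}. 1 * (\<Prod>y\<in>{1..n}-{j}-{x}. (t j - t y)))) (at (t j))"
      by (rule has_field_derivative_prod) (auto intro!: derivative_eq_intros)
    then obtain N' where N': "(?N has_field_derivative N') (at (t j))" by blast
    have 1: "(poly F has_field_derivative c * D j) (at (t j))"
      unfolding pF by (rule derivative_eq_intros N' refl)+ (simp add: D_def)
    obtain W' where W': "(W has_field_derivative W') (at (t j))"
    proof -
      have "(W has_field_derivative (\<Sum>x\<in>{1..n}. 1 * (\<Prod>y\<in>{1..n}-{x}. (t j - a y)))) (at (t j))"
        unfolding pole_product_def[abs_def]
        by (rule has_field_derivative_prod) (auto intro!: derivative_eq_intros)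
      thus thesis using that by blast
    qed
    note B' = blaschke_has_field_derivative[OF tcirc[OF j]]
    have "((\<lambda>x. W x * (B x - w)) has_field_derivative W (t j) * (w / t j * of_real (weight (t j)))) (at (t j))"
      by (rule derivative_eq_intros W' B' refl)+ (simp add: Bt[OF j])
    hence 2: "(poly F has_field_derivative W (t j) * (w / t j * of_real (weight (t j)))) (at (t j))"
      by (rule has_field_derivative_transform_within_open[OF _ open_nonpoles]) (auto simp: Wt[OF j] F_eq)
    show ?thesis using DERIV_unique[OF 1 2] .
  qed

  \<comment> \<open>The factor \<open>t j\<close> brought in by B'(t j) is the one that makes t / (z
    - t)^2 have constant argument; only 1 / (w z) and a positive number remain.\<close>
  have coef: "- (1 / (c * D j)) * W (t j) / (z - t j)\<^sup>2 = 1 / (w * z) * (1 / of_real (weight (t j) * (norm (z - t j))\<^sup>2))"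
    if j: "j \<in> {1..n}" for j
  proof -
    have "- (1 / (c * D j)) * W (t j) / (z - t j)\<^sup>2 = - (t j / (z - t j)\<^sup>2) / (w * of_real (weight (t j)))"
      unfolding cD[OF j] using Wt[OF j] by simp
    also have "\<dots> = 1 / (w * z) * (1 / of_real (weight (t j) * (norm (z - t j))\<^sup>2))"
      unfolding unit_circle_divide_diff_sq[OF z(1) tcirc[OF j] zt[OF j]] by simp
    finally show ?thesis .
  qed

  define c' where "c' = - ((B z - w)\<^sup>2 * (1 / (w * z)))"
  show ?thesis
  proof (intro exI[of _ c'] allI impI)
    fix P :: "complex poly"
    assume deg: "degree P \<le> n"
    let ?R = "\<lambda>x. poly P x / W x"
    obtain C where C: "\<And>x. poly P x = C * Q x + (\<Sum>j=1..n. poly P (t j) / D j * (\<Prod>i\<in>{1..n}-{j}. (x - t i)))"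
      using poly_lagrange_leading[OF inj deg] unfolding Q_def D_def by blast
    \<comment> \<open>The partial fraction expansion of R / (B - w), obtained by dividing the
      interpolation formula for \<open>P\<close> by F = c Q.\<close>
    define G where "G x = C / c + (\<Sum>j=1..n. poly P (t j) / (c * D j) / (x - t j))" for x
    have G_eq: "?R x = G x * (B x - w)" if x: "W x \<noteq> 0" "B x \<noteq> w" for x
    proof -
      have xt: "x \<noteq> t j" if "j \<in> {1..n}" for j using Bt[OF that] x by auto
      have Q0: "Q x \<noteq> 0" unfolding Q_def using xt by auto
      have rem: "(\<Prod>i\<in>{1..n}-{j}. (x - t i)) = Q x / (x - t j)" if "j \<in> {1..n}" for j
        unfolding Q_def using prod.remove[OF finite_atLeastAtMost that, of "\<lambda>i. x - t i"] xt[OF that] by simp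
      have "poly P x = C * Q x + (\<Sum>j=1..n. poly P (t j) / D j * (Q x / (x - t j)))"
        unfolding C[of x] by (intro arg_cong2[of _ _ _ _ "(+)"] sum.cong refl) (simp only: rem)
      also have "\<dots> = c * Q x * G x"
        unfolding G_def using c0 by (simp add: distrib_left sum_distrib_left mult_ac)
      also have "c * Q x = W x * (B x - w)"
        using FQ F_eq[OF x(1)] by metis
      finally show ?thesis using x by simp
    qed
    define G' where "G' = (\<Sum>j=1..n. - (poly P (t j) / (c * D j)) / (z - t j)\<^sup>2)"
    have "(G has_field_derivative 0 + G') (at z)"
      unfolding G_def[abs_def] G'_def
      by (intro DERIV_add DERIV_const DERIV_sum)
         (auto intro!: derivative_eq_intros simp: zt c0 D0 power2_eq_square)
    hence G'_d: "(G has_field_derivative G') (at z)" by simp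
    note B' = blaschke_has_field_derivative[OF z(1)]
    have dB: "deriv B z = B z / z * of_real (weight z)"
      using DERIV_imp_deriv[OF B'] .
    have prod_d: "((\<lambda>x. G x * (B x - w)) has_field_derivative G' * (B z - w) + deriv B z * G z) (at z)"
      unfolding dB by (rule derivative_eq_intros G'_d B' refl)+ simp
    have op: "open {x. W x \<noteq> 0 \<and> B x \<noteq> w}"
    proof -
      \<comment> \<open>Passing to the polynomial \<open>F\<close> gives openness without continuity
        of \<open>B\<close>.\<close>
      have "{x. W x \<noteq> 0 \<and> B x \<noteq> w} = {x. W x \<noteq> 0} \<inter> {x. poly F x \<noteq> 0}"
        using F_eq by auto
      moreover have "open {x. poly F x \<noteq> 0}"
        by (intro open_Collect_neq continuous_intros)
      ultimately show ?thesis using open_nonpoles by auto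
    qed
    have "(?R has_field_derivative G' * (B z - w) + deriv B z * G z) (at z)"
      using prod_d op
      by (rule has_field_derivative_transform_within_open) (auto simp: G_eq z pole_product_nonzero)
    hence dR: "deriv ?R z = G' * (B z - w) + deriv B z * G z"
      by (rule DERIV_imp_deriv)
    have Rz: "?R z = G z * (B z - w)"
      using G_eq z pole_product_nonzero by blast
    have "G' = (\<Sum>j=1..n. ?R (t j) * (- (1 / (c * D j)) * W (t j) / (z - t j)\<^sup>2))"
      unfolding G'_def by (intro sum.cong) (use Wt in auto)
    also have "\<dots> = (\<Sum>j=1..n. ?R (t j) * (1 / (w * z) * (1 / of_real (weight (t j) * (norm (z - t j))\<^sup>2))))"
      by (intro sum.cong refl) (simp only: coef)
    also have "\<dots> = 1 / (w * z) * (\<Sum>j=1..n. ?R (t j) / of_real (weight (t j) * (norm (z - t j))\<^sup>2))"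
      unfolding sum_distrib_left by (intro sum.cong refl) simp
    finally have G'_eq: "G' = 1 / (w * z) * (\<Sum>j=1..n. ?R (t j) / of_real (weight (t j) * (norm (z - t j))\<^sup>2))" .
    \<comment> \<open>With R = G (B - w) the terms containing \<open>G\<close> itself cancel,
      leaving only its derivative.\<close>
    have "deriv B z * ?R z - deriv ?R z * (B z - w) = - ((B z - w)\<^sup>2 * G')"
      unfolding Rz dR by (simp add: power2_eq_square algebra_simps)
    also have "\<dots> = c' * (\<Sum>j=1..n. ?R (t j) / of_real (weight (t j) * (norm (z - t j))\<^sup>2))"
      unfolding G'_eq c'_def by simp
    finally show "deriv B z * ?R z - deriv ?R z * (B z - w) =
      c' * (\<Sum>j=1..n. ?R (t j) / of_real (weight (t j) * (norm (z - t j))\<^sup>2))" .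
  qed
qed

text \<open>The triangle inequality is an equality for R = 1, since the node weights are nonnegative
  up to a common factor; this case evaluates their total.\<close>

lemma interpolation_bound:
  assumes w: "norm w = 1" and t: "enumerates_roots n a w t"
    and z: "norm z = 1" and deg: "degree P \<le> n"
    and M: "\<And>j. j \<in> {1..n} \<Longrightarrow> norm (poly P (t j) / W (t j)) \<le> M"
  shows "norm (deriv B z * (poly P z / W z) - deriv (\<lambda>x. poly P x / W x) z * (B z - w)) \<le> weight z * M"
proof (cases "B z = w")
  \<comment> \<open>Here \<open>z\<close> is itself a node and the second term vanishes, so the
    bound is immediate.\<close>
  case True
  then obtain j where j: "j \<in> {1..n}" "z = t j"
    using t unfolding enumerates_roots_def bij_betw_def by blast
  have "norm (deriv B z * (poly P z / W z)) \<le> weight z * M"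
    unfolding norm_mult norm_deriv_blaschke[OF z]
    using M[OF j(1)] weight_pos[OF z] j(2) by (intro mult_left_mono) auto
  thus ?thesis using True by simp
next
  case False
  have circ: "norm (t j) = 1" if "j \<in> {1..n}" for j
  proof -
    have "B (t j) = w"
      using t that unfolding enumerates_roots_def bij_betw_def by blast
    thus ?thesis using norm_eq_1_of_blaschke w by simp
  qed
  define h where "h j = 1 / (weight (t j) * (norm (z - t j))\<^sup>2)" for j
  have h: "h j \<ge> 0" if "j \<in> {1..n}" for j
    unfolding h_def using weight_pos[OF circ[OF that]] by simp
  obtain c where c: "\<And>P. degree P \<le> n \<Longrightarrow>
    deriv B z * (poly P z / W z) - deriv (\<lambda>x. poly P x / W x) z * (B z - w) =
    c * (\<Sum>j=1..n. poly P (t j) / W (t j) * of_real (h j))"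
    using interpolation_formula[OF w t z False] unfolding h_def by auto
  \<comment> \<open>\<open>V\<close> is \<open>W\<close> as a polynomial, so the choice P = V
    realises R = 1 near the circle and determines the size of \<open>c\<close>.\<close>
  define V where "V = (\<Prod>j=1..n. [:- a j, 1:])"
  have polyV: "poly V x = W x" for x
    by (simp add: V_def pole_product_def poly_prod)
  have degV: "degree V \<le> n"
    unfolding V_def by (subst degree_prod_eq_sum_degree) auto
  have "((\<lambda>x. poly V x / W x) has_field_derivative 0) (at z)"
    by (rule has_field_derivative_transform_within_open[OF DERIV_const[of 1] open_nonpoles])
       (auto simp: polyV pole_product_nonzero[OF z])
  hence "deriv (\<lambda>x. poly V x / W x) z = 0"
    by (rule DERIV_imp_deriv)
  hence "deriv B z = c * (\<Sum>j=1..n. poly V (t j) / W (t j) * of_real (h j))"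
    using c[OF degV] pole_product_nonzero[OF z] by (simp only: polyV) simp
  also have "(\<Sum>j=1..n. poly V (t j) / W (t j) * of_real (h j)) = (\<Sum>j=1..n. of_real (h j))"
    by (intro sum.cong) (auto simp: polyV pole_product_nonzero circ)
  finally have "deriv B z = c * (\<Sum>j=1..n. of_real (h j))" .
  hence "norm (deriv B z) = norm c * norm (\<Sum>j=1..n. complex_of_real (h j))"
    by (simp add: norm_mult)
  also have "norm (\<Sum>j=1..n. complex_of_real (h j)) = (\<Sum>j=1..n. h j)"
    unfolding of_real_sum[symmetric] norm_of_real using h by (intro abs_of_nonneg sum_nonneg) blast
  finally have wt: "weight z = norm c * (\<Sum>j=1..n. h j)"
    by (simp add: norm_deriv_blaschke[OF z])
  have "norm (\<Sum>j=1..n. poly P (t j) / W (t j) * of_real (h j)) \<le> (\<Sum>j=1..n. M * h j)"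
  proof (rule sum_norm_le)
    fix j assume j: "j \<in> {1..n}"
    show "norm (poly P (t j) / W (t j) * of_real (h j)) \<le> M * h j"
      unfolding norm_mult using mult_right_mono[OF M[OF j] h[OF j]] h[OF j] by simp
  qed
  hence "norm c * norm (\<Sum>j=1..n. poly P (t j) / W (t j) * of_real (h j)) \<le> norm c * (\<Sum>j=1..n. M * h j)"
    by (rule mult_left_mono) simp
  thus ?thesis
    unfolding c[OF deg] wt norm_mult[of c] by (simp add: sum_distrib_left mult_ac)
qed

section \<open>Combining the bounds for w and -w\<close>

lemma Bernstein_pair:
  assumes w: "norm w = 1" and t: "enumerates_roots n a w t" and s: "enumerates_roots n a (- w) s"
    and z: "norm z = 1" and deg: "degree P \<le> n"
    and M: "\<And>j. j \<in> {1..n} \<Longrightarrow> norm (poly P (t j) / W (t j)) \<le> M1"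
      "\<And>j. j \<in> {1..n} \<Longrightarrow> norm (poly P (s j) / W (s j)) \<le> M2"
  defines "R \<equiv> \<lambda>x. poly P x / W x"
  shows "(norm (deriv R z))\<^sup>2 + (norm (of_real (weight z) * R z - z * deriv R z))\<^sup>2
    \<le> (weight z)\<^sup>2 * (M1\<^sup>2 + M2\<^sup>2) / 2"
proof -
  have nz: "z \<noteq> 0" using z by auto
  \<comment> \<open>The expressions bounded for \<open>w\<close> and \<open>- w\<close> are u + v
    and u - v, ready for the parallelogram law.\<close>
  define u where "u = deriv B z * R z - deriv R z * B z"
  define v where "v = deriv R z * w"
  have "u + v = deriv B z * R z - deriv R z * (B z - w)"
    "u - v = deriv B z * R z - deriv R z * (B z - (- w))"
    by (auto simp: u_def v_def algebra_simps)
  hence "norm (u + v) \<le> weight z * M1" "norm (u - v) \<le> weight z * M2"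
    using interpolation_bound[OF w t z deg M(1)] interpolation_bound[OF _ s z deg M(2)] w
    unfolding R_def by auto
  hence "(norm (u + v))\<^sup>2 + (norm (u - v))\<^sup>2 \<le> (weight z * M1)\<^sup>2 + (weight z * M2)\<^sup>2"
    by (intro add_mono power_mono) auto
  moreover have "(norm (u + v))\<^sup>2 + (norm (u - v))\<^sup>2 = 2 * (norm u)\<^sup>2 + 2 * (norm v)\<^sup>2"
    unfolding cmod_power2 by (simp add: power2_eq_square algebra_simps)
  moreover have "norm v = norm (deriv R z)"
    using w by (simp add: v_def norm_mult)
  \<comment> \<open>The prefactor has modulus 1, by the formula for B'.\<close>
  moreover have "u = B z / z * (of_real (weight z) * R z - z * deriv R z)"
    unfolding u_def DERIV_imp_deriv[OF blaschke_has_field_derivative[OF z]]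
    using nz by (simp add: algebra_simps)
  hence "norm u = norm (of_real (weight z) * R z - z * deriv R z)"
    using z norm_blaschke[OF z] by (simp add: norm_mult norm_divide)
  ultimately show ?thesis
    by (simp add: power_mult_distrib algebra_simps)
qed

section \<open>The influence of the zeros\<close>

text \<open>z R'/R is the sum of z / (z - b j) minus the sum of z / (z - a j). The zeros are
  estimated termwise; the poles contribute exactly n/2 - |B'|/2.\<close>

lemma Re_log_derivative_le:
  fixes m :: nat and b :: "nat \<Rightarrow> complex"
  assumes z: "norm z = 1" and P: "P = smult \<alpha> (\<Prod>j=1..m. [:- b j, 1:])"
    and b: "\<And>j. j \<in> {1..m} \<Longrightarrow> norm (b j) \<ge> 1"
  defines "R \<equiv> \<lambda>x. poly P x / W x"
  assumes Rz: "R z \<noteq> 0"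
  shows "Re (z * deriv R z / R z) \<le> (\<Sum>j=1..m. 1 / (1 + norm (b j))) - n / 2 + weight z / 2"
proof -
  have P_eq: "poly P x = \<alpha> * (\<Prod>j=1..m. (x - b j))" for x
    by (simp add: P poly_prod)
  \<comment> \<open>Zeros may lie on the circle; R z \<noteq> 0 keeps \<open>z\<close> away from
    them.\<close>
  have zb: "z - b j \<noteq> 0" if "j \<in> {1..m}" for j
  proof
    assume "z - b j = 0"
    hence "(\<Prod>j=1..m. (z - b j)) = 0"
      using that by (intro prod_zero finite_atLeastAtMost bexI[of _ j])
    thus False using Rz unfolding R_def P_eq by simp
  qed
  have za: "z - a j \<noteq> 0" if "j \<in> {1..n}" for j
    using norm_pole[OF that] z by auto
  have 1: "((\<lambda>x. \<Prod>j=1..m. (x - b j)) has_field_derivative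
      (\<Prod>j=1..m. (z - b j)) * (\<Sum>j=1..m. 1 / (z - b j))) (at z)"
    by (rule has_field_derivative_prod') (use zb in \<open>auto intro!: derivative_eq_intros\<close>)
  have 2: "(W has_field_derivative W z * (\<Sum>j=1..n. 1 / (z - a j))) (at z)"
    unfolding pole_product_def[abs_def]
    by (rule has_field_derivative_prod') (use za in \<open>auto intro!: derivative_eq_intros\<close>)
  have "(R has_field_derivative R z * ((\<Sum>j=1..m. 1 / (z - b j)) - (\<Sum>j=1..n. 1 / (z - a j)))) (at z)"
    unfolding R_def P_eq
    by (rule derivative_eq_intros 1 2 refl pole_product_nonzero[OF z])+
       (use pole_product_nonzero[OF z] in \<open>simp add: field_simps\<close>)
  hence "z * deriv R z / R z = z * ((\<Sum>j=1..m. 1 / (z - b j)) - (\<Sum>j=1..n. 1 / (z - a j)))"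
    using Rz by (simp add: DERIV_imp_deriv)
  also have "\<dots> = (\<Sum>j=1..m. z / (z - b j)) - (\<Sum>j=1..n. z / (z - a j))"
    by (simp add: right_diff_distrib sum_distrib_left)
  finally have "Re (z * deriv R z / R z) = (\<Sum>j=1..m. Re (z / (z - b j))) - (\<Sum>j=1..n. Re (z / (z - a j)))"
    by (simp only: minus_complex.sel Re_sum)
  moreover have "(\<Sum>j=1..m. Re (z / (z - b j))) \<le> (\<Sum>j=1..m. 1 / (1 + norm (b j)))"
    by (intro sum_mono Re_divide_diff_le z b) (use zb in auto)
  moreover have "(\<Sum>j=1..n. Re (z / (z - a j))) =
      (\<Sum>j=1..n. 1 / 2 - ((norm (a j))\<^sup>2 - 1) / (norm (z - a j))\<^sup>2 / 2)"
    by (intro sum.cong refl, subst Re_divide_diff_eq[OF z]) (use za in \<open>auto simp: diff_divide_distrib\<close>)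
  hence "(\<Sum>j=1..n. Re (z / (z - a j))) = n / 2 - weight z / 2"
    unfolding weight_def by (simp add: sum_subtractf sum_divide_distrib)
  ultimately show ?thesis by linarith
qed

end

section \<open>Assembling the estimate\<close>

theorem theorem2:
  fixes n m :: nat
    and a b t s :: "nat \<Rightarrow> complex"
    and k M1 M2 :: real
    and \<alpha> lam z :: complex
    and P :: "complex poly"
    and R :: "complex \<Rightarrow> complex"
  assumes "n \<ge> 1"
    and "\<And>j. j \<in> {1..n} \<Longrightarrow> norm (a j) > 1"
    and "k \<ge> 1"
    and "R \<in> rational_space n a"
    and "R = (\<lambda>x. poly P x / pole_product n a x)"
    and "P = smult \<alpha> (\<Prod>j=1..m. [:- b j, 1:])"
    and "\<alpha> \<noteq> 0"
    and "m \<le> n"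
    and "\<And>j. j \<in> {1..m} \<Longrightarrow> norm (b j) \<ge> k"
    and "norm lam = 1"
    and "enumerates_roots n a lam t"
    and "enumerates_roots n a (- lam) s"
    and "M1 = Max ((\<lambda>j. norm (R (t j))) ` {1..n})"
    and "M2 = Max ((\<lambda>j. norm (R (s j))) ` {1..n})"
    and "norm z = 1"
  shows "norm (deriv R z) \<le>
    1/2 * sqrt ((norm (deriv (blaschke n a) z))^2
      - (2 * real n * (k - 1)) / (k + 1)
          * ((norm (R z))^2 * norm (deriv (blaschke n a) z) / (M1^2 + M2^2))
      - (4 * (norm (R z))^2 * norm (deriv (blaschke n a) z)) / (M1^2 + M2^2)
          * (real n / (1 + k) - (\<Sum>j=1..m. 1 / (1 + norm (b j)))))
    * sqrt (M1^2 + M2^2)"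
proof -
  interpret exterior_poles n a
    using assms by unfold_locales auto
  have z: "norm z = 1" using assms by simp
  have R: "R = (\<lambda>x. poly P x / W x)" using assms by simp
  have deg: "degree P \<le> n"
    using assms by (simp add: degree_prod_eq_sum_degree)
  let ?w = "weight z"
  define S where "S = (\<Sum>j=1..m. 1 / (1 + norm (b j)))"
  define M where "M = M1\<^sup>2 + M2\<^sup>2"
  define r where "r = (norm (R z))\<^sup>2"
  have w: "?w > 0" using weight_pos[OF z] .
  have M1: "norm (R (t j)) \<le> M1" and M2: "norm (R (s j)) \<le> M2" if "j \<in> {1..n}" for j
    using that assms(13,14) by (auto intro!: Max_ge)
  have pair: "(norm (deriv R z))\<^sup>2 + (norm (of_real ?w * R z - z * deriv R z))\<^sup>2 \<le> ?w\<^sup>2 * M / 2"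
    using Bernstein_pair[OF assms(10-12) z deg, of M1 M2] M1 M2 unfolding R M_def by blast
  have reversed: "(norm (of_real ?w * R z - z * deriv R z))\<^sup>2
      \<ge> (norm (deriv R z))\<^sup>2 + r * ?w * (n - 2 * S)"
  proof (cases "R z = 0")
    \<comment> \<open>Then \<open>r\<close> is 0 and both squares equal |R'(z)|^2.\<close>
    case True
    thus ?thesis using z by (simp add: r_def norm_mult)
  next
    case False
    define q where "q = z * deriv R z / R z"
    have q: "z * deriv R z = R z * q" using False by (simp add: q_def)
    have "Re q \<le> S - n / 2 + ?w / 2"
      using Re_log_derivative_le[OF z assms(6), of] False assms(3,9) unfolding q_def S_def R by force
    hence "2 * ?w * Re q \<le> 2 * ?w * (S - n / 2 + ?w / 2)"
      using w by (intro mult_left_mono) auto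
    \<comment> \<open>Expanding |weight - q|^2 turns the upper bound on Re q into a lower bound for
      this square; multiplying by \<open>r\<close> restores \<open>R\<close> and R'.\<close>
    hence "(norm q)\<^sup>2 + ?w * (n - 2 * S) \<le> (norm q)\<^sup>2 + ?w\<^sup>2 - 2 * ?w * Re q"
      by (simp add: algebra_simps power2_eq_square)
    also have "\<dots> = (norm (of_real ?w - q))\<^sup>2"
      unfolding cmod_power2 by (simp add: power2_eq_square algebra_simps)
    finally have "r * ((norm q)\<^sup>2 + ?w * (n - 2 * S)) \<le> r * (norm (of_real ?w - q))\<^sup>2"
      by (intro mult_left_mono) (auto simp: r_def)
    also have "r * (norm (of_real ?w - q))\<^sup>2 = (norm (of_real ?w * R z - z * deriv R z))\<^sup>2"
      unfolding q r_def power_mult_distrib[symmetric] norm_mult[symmetric] by (simp add: algebra_simps)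
    finally have "r * (norm q)\<^sup>2 + r * ?w * (n - 2 * S) \<le> \<dots>"
      by (simp add: algebra_simps)
    moreover have "r * (norm q)\<^sup>2 = (norm (deriv R z))\<^sup>2"
      unfolding r_def power_mult_distrib[symmetric] norm_mult[symmetric] q[symmetric]
      using z by (simp add: norm_mult)
    ultimately show ?thesis by simp
  qed
  have sq: "(norm (deriv R z))\<^sup>2 \<le> (?w\<^sup>2 * M - 2 * (r * ?w * (n - 2 * S))) / 4"
    using pair reversed by simp
  define E where "E = ?w\<^sup>2 - (2 * real n * (k - 1)) / (k + 1) * (r * ?w / M)
      - (4 * r * ?w) / M * (real n / (1 + k) - S)"
  have "(norm (deriv R z))\<^sup>2 \<le> E * M / 4"
  proof (cases "M = 0")
    \<comment> \<open>The right side is 0, and \<open>pair\<close> forces R'(z) = 0.\<close>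
    case True
    thus ?thesis using pair by (simp add: sum_power2_le_zero_iff)
  next
    case False
    have "E * M = ?w\<^sup>2 * M - r * ?w * (2 * n * (k - 1) / (k + 1) + 4 * n / (1 + k) - 4 * S)"
    proof -
      define X where "X = r * ?w / M"
      have "r * ?w = X * M" "4 * r * ?w / M = 4 * X" using False by (auto simp: X_def)
      thus ?thesis
        unfolding E_def X_def[symmetric] by (simp add: algebra_simps add_divide_distrib)
    qed
    \<comment> \<open>The terms containing \<open>k\<close> add up to 2 n, so E M / 4 is exactly the
      bound in \<open>sq\<close>.\<close>
    also have "2 * n * (k - 1) / (k + 1) + 4 * n / (1 + k) = 2 * real n * ((k - 1) + 2) / (1 + k)"
      by (simp only: distrib_left add_divide_distrib add.commute[of k 1])
    also have "\<dots> = 2 * real n"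
      using assms(3) by simp
    finally show ?thesis using sq by (simp add: algebra_simps)
  qed
  hence "norm (deriv R z) \<le> sqrt (E * M / 4)"
    by (rule real_le_rsqrt)
  \<comment> \<open>The total \<open>sqrt\<close> is odd and multiplicative on all reals, so the
    sign of \<open>E\<close> need not be known.\<close>
  also have "\<dots> = 1 / 2 * sqrt E * sqrt M"
    by (simp add: real_sqrt_mult real_sqrt_divide)
  finally show ?thesis
    unfolding E_def M_def r_def S_def norm_deriv_blaschke[OF z] .
qed

end
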